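(* When the physical spacetime is the Minkowski spacetime, the critical point $(x,y)=(0,0)$ of the energy functional $E(x,y)$ associated with the surface $S=\{t=t_0,\ r=r_0\}$ is a saddle point.
   Context: The Minkowski metric in spherical coordinates has the form \[g=F\,dt^2+2G\,dt\,d\phi+H\,d\phi^2+R^2dr^2+\Sigma^2d\theta^2\] with $F=-1$, $G=0$, $H=r^2\sin^2\theta$, $R=1$, $\Sigma=r$. For smooth functions $x,y$ on $[0,\pi]$ with $x'(0)=x'(\pi)=y(0)=y(\pi)=0$, the (Chen-Nester-Tung) energy functional is $E(x,y)=\frac14\int_0^\pi\mathfrak B(x,y)\,d\theta$ with \[\begin{split}\mathfrak B(x,y)=&-\frac{\alpha(H\Sigma^2)_r}{2\sqrt H R^2\Sigma^2}-\sqrt H\left(\frac{H_{\theta\theta}-2l}{\beta}+\frac{R_\theta xy}{R\alpha}-\frac{xy^3\beta+H_\theta\alpha\Sigma^2}{l\alpha\beta\Sigma}\Sigma_\theta\right)\\&+\frac{\sqrt H\,y\,x_\theta}{\alpha}+\frac{\sqrt H\,y(H_\theta\alpha-xy\beta)}{l\alpha\beta}y_\theta,\end{split}\] \[\alpha=\sqrt{x^2\Sigma^2+R^2l},\qquad\beta=\sqrt{-H_\theta^2+4Hl},\qquad l=y^2+\Sigma^2,\] where all metric functions and their derivatives are evaluated at $r=r_0>0$, and subscripts $r,\theta$ denote partial derivatives. The pair $(0,0)$ is a critical point of $E$. The second variation is $\delta^2E_{(0,0)}(\xi,\zeta)=\frac{d^2}{d\epsilon^2}\big|_{\epsilon=0}E(\epsilon\xi,\epsilon\zeta)$;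 "saddle point" means a critical point at which the second variation takes both negative and positive values on admissible smooth variations (those with $\xi'(0)=\xi'(\pi)=\zeta(0)=\zeta(\pi)=0$). *)

theory Defs
  imports "HOL-Analysis.Analysis"
begin

(* Coefficients of a metric
     F dt^2 + 2 G dt dphi + H dphi^2 + R^2 dr^2 + Sigma^2 dtheta^2
   as functions of (r, theta), in this order.  They do not depend on t and phi,
   so the energy of {t = t0, r = r0} depends only on r0. *)

record spacetime_metric =
  cF :: "real \<Rightarrow> real \<Rightarrow> real"
  cG :: "real \<Rightarrow> real \<Rightarrow> real"
  cH :: "real \<Rightarrow> real \<Rightarrow> real"
  cR :: "real \<Rightarrow> real \<Rightarrow> real"
  cS :: "real \<Rightarrow> real \<Rightarrow> real"

definition minkowski :: spacetime_metric where
  "minkowski =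
    \<lparr> cF = (\<lambda>r \<theta>. - 1),
      cG = (\<lambda>r \<theta>. 0),
      cH = (\<lambda>r \<theta>. r\<^sup>2 * (sin \<theta>)\<^sup>2),
      cR = (\<lambda>r \<theta>. 1),
      cS = (\<lambda>r \<theta>. r) \<rparr>"

(* Derivative of a function on [0, pi], one-sided at the endpoints. *)

definition dth :: "(real \<Rightarrow> real) \<Rightarrow> real \<Rightarrow> real" where
  "dth f \<theta> = vector_derivative f (at \<theta> within {0..pi})"

(* C-infinity on the closed interval; values outside [0, pi] are irrelevant. *)

definition smooth_0pi :: "(real \<Rightarrow> real) \<Rightarrow> bool" where
  "smooth_0pi f \<longleftrightarrow> (\<forall>n. (dth ^^ n) f differentiable_on {0..pi})"

(* The boundary conditions are homogeneous, so this describes both the domain of the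
   energy functional and its admissible variations. *)

definition admissible :: "(real \<Rightarrow> real) \<Rightarrow> (real \<Rightarrow> real) \<Rightarrow> bool" where
  "admissible x y \<longleftrightarrow> smooth_0pi x \<and> smooth_0pi y \<and>
     dth x 0 = 0 \<and> dth x pi = 0 \<and> y 0 = 0 \<and> y pi = 0"

(* For the Minkowski metric H = beta = 0 at theta = 0 and theta = pi, where the integrand
   is a division by zero; these two points do not affect the integral. *)

definition energy_density ::
    "spacetime_metric \<Rightarrow> real \<Rightarrow> (real \<Rightarrow> real) \<Rightarrow> (real \<Rightarrow> real) \<Rightarrow> real \<Rightarrow> real" where
  "energy_density g r x y \<theta> =
    (let H = cH g r \<theta>;
         R = cR g r \<theta>;
         S = cS g r \<theta>;
         HS2\<^sub>r = deriv (\<lambda>\<rho>. cH g \<rho> \<theta> * (cS g \<rho> \<theta>)\<^sup>2) r;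
         H\<^sub>\<theta> = deriv (cH g r) \<theta>;
         H\<^sub>\<theta>\<^sub>\<theta> = deriv (deriv (cH g r)) \<theta>;
         R\<^sub>\<theta> = deriv (cR g r) \<theta>;
         S\<^sub>\<theta> = deriv (cS g r) \<theta>;
         X = x \<theta>;
         Y = y \<theta>;
         X\<^sub>\<theta> = dth x \<theta>;
         Y\<^sub>\<theta> = dth y \<theta>;
         l = Y\<^sup>2 + S\<^sup>2;
         \<alpha> = sqrt (X\<^sup>2 * S\<^sup>2 + R\<^sup>2 * l);
         \<beta> = sqrt (- (H\<^sub>\<theta>\<^sup>2) + 4 * H * l)
     in - (\<alpha> * HS2\<^sub>r / (2 * sqrt H * R\<^sup>2 * S\<^sup>2))
        - sqrt H * ((H\<^sub>\<theta>\<^sub>\<theta> - 2 * l) / \<beta> + R\<^sub>\<theta> * X * Y / (R * \<alpha>)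
            - (X * Y ^ 3 * \<beta> + H\<^sub>\<theta> * \<alpha> * S\<^sup>2) / (l * \<alpha> * \<beta> * S) * S\<^sub>\<theta>)
        + sqrt H * Y * X\<^sub>\<theta> / \<alpha>
        + sqrt H * Y * (H\<^sub>\<theta> * \<alpha> - X * Y * \<beta>) / (l * \<alpha> * \<beta>) * Y\<^sub>\<theta>)"

definition energy ::
    "spacetime_metric \<Rightarrow> real \<Rightarrow> (real \<Rightarrow> real) \<Rightarrow> (real \<Rightarrow> real) \<Rightarrow> real" where
  "energy g r x y = 1 / 4 * integral {0..pi} (energy_density g r x y)"

definition along ::
    "((real \<Rightarrow> real) \<Rightarrow> (real \<Rightarrow> real) \<Rightarrow> real) \<Rightarrow> (real \<Rightarrow> real) \<Rightarrow> (real \<Rightarrow> real) \<Rightarrow>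
     (real \<Rightarrow> real) \<Rightarrow> (real \<Rightarrow> real) \<Rightarrow> real \<Rightarrow> real" where
  "along E x y \<xi> \<zeta> \<epsilon> = E (\<lambda>\<theta>. x \<theta> + \<epsilon> * \<xi> \<theta>) (\<lambda>\<theta>. y \<theta> + \<epsilon> * \<zeta> \<theta>)"

definition critical_point ::
    "((real \<Rightarrow> real) \<Rightarrow> (real \<Rightarrow> real) \<Rightarrow> real) \<Rightarrow> (real \<Rightarrow> real) \<Rightarrow> (real \<Rightarrow> real) \<Rightarrow> bool" where
  "critical_point E x y \<longleftrightarrow> admissible x y \<and>
     (\<forall>\<xi> \<zeta>. admissible \<xi> \<zeta> \<longrightarrow> (along E x y \<xi> \<zeta> has_real_derivative 0) (at 0))"

(* The second variation exists in direction (xi, zeta) and equals c.  Stated as a relation,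
   because deriv has an unspecified value where the derivative does not exist. *)

definition has_second_variation ::
    "((real \<Rightarrow> real) \<Rightarrow> (real \<Rightarrow> real) \<Rightarrow> real) \<Rightarrow> (real \<Rightarrow> real) \<Rightarrow> (real \<Rightarrow> real) \<Rightarrow>
     (real \<Rightarrow> real) \<Rightarrow> (real \<Rightarrow> real) \<Rightarrow> real \<Rightarrow> bool" where
  "has_second_variation E x y \<xi> \<zeta> c \<longleftrightarrow>
     (\<forall>\<^sub>F \<epsilon> in nhds 0. along E x y \<xi> \<zeta> field_differentiable at \<epsilon>) \<and>
     (deriv (along E x y \<xi> \<zeta>) has_real_derivative c) (at 0)"

definition saddle_point ::
    "((real \<Rightarrow> real) \<Rightarrow> (real \<Rightarrow> real) \<Rightarrow> real) \<Rightarrow> (real \<Rightarrow> real) \<Rightarrow> (real \<Rightarrow> real) \<Rightarrow> bool" where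
  "saddle_point E x y \<longleftrightarrow> critical_point E x y \<and>
     (\<exists>\<xi> \<zeta> c. admissible \<xi> \<zeta> \<and> has_second_variation E x y \<xi> \<zeta> c \<and> c < 0) \<and>
     (\<exists>\<xi> \<zeta> c. admissible \<xi> \<zeta> \<and> has_second_variation E x y \<xi> \<zeta> c \<and> c > 0)"

end

theory Submission
  imports Defs
begin

text \<open>
  An admissible \<open>\<zeta>\<close> vanishes at both poles, so \<open>\<zeta> = sin \<theta> \<eta>\<close> with \<open>\<eta>\<close> continuous on \<open>[0, pi]\<close>. This
  cancels the zero of \<open>\<beta>\<close> at the poles: along \<open>(\<epsilon> \<xi>, \<epsilon> \<zeta>)\<close> the density becomes a \<open>C\<^sup>1\<close> function of
  \<open>s = \<epsilon>\<^sup>2\<close> and \<open>\<theta>\<close>. Hence the energy is \<open>G (\<epsilon>\<^sup>2) / 4\<close>, which is critical at \<open>\<epsilon> = 0\<close> with second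
  derivative \<open>G' 0 / 2\<close>, that is,
  \<open>1/2 \<integral> - sin \<theta> (r \<xi>\<^sup>2 + \<zeta>\<^sup>2 / r) + sin \<theta> \<zeta> \<xi>' + cos \<theta> \<zeta> \<zeta>' / r d\<theta>\<close>.
  This is \<open>- r\<close> at \<open>(1, 0)\<close> and \<open>3 r / 5\<close> at \<open>(- cos 2\<theta>, 2 r sin 2\<theta>)\<close>.
\<close>

section \<open>Smooth functions on the closed interval and division by the sine\<close>

text \<open>Pointwise l'Hopital rule: both difference quotients converge and their common factor
  \<open>x - a\<close> cancels. It uses derivatives at \<open>a\<close> alone and relative to
  \<open>S\<close>, so it applies at the endpoints of the interval.\<close>

lemma tendsto_quotient_of_zeros:
  fixes f g :: "real \<Rightarrow> real"
  assumes f: "(f has_real_derivative D) (at a within S)" and g: "(g has_real_derivative E) (at a within S)"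
    and "f a = 0" "g a = 0" "E \<noteq> 0"
  shows "((\<lambda>x. f x / g x) \<longlongrightarrow> D / E) (at a within S)"
proof -
  have "((\<lambda>x. ((f x - f a) / (x - a)) / ((g x - g a) / (x - a))) \<longlongrightarrow> D / E) (at a within S)"
    using f g \<open>E \<noteq> 0\<close> unfolding has_field_derivative_iff by (rule tendsto_divide)
  moreover have "\<forall>\<^sub>F x in at a within S. ((f x - f a) / (x - a)) / ((g x - g a) / (x - a)) = f x / g x"
    unfolding eventually_at_filter using assms by (intro always_eventually) auto
  ultimately show ?thesis
    by (rule Lim_transform_eventually)
qed

lemma dth_eqI:
  assumes "(f has_vector_derivative D) (at \<theta> within {0..pi})" "\<theta> \<in> {0..pi}"
  shows "dth f \<theta> = D"
  unfolding dth_def using vector_derivative_within_cbox[of 0 pi \<theta> f D] assms by simp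

lemma smooth_0pi_has_vector_derivative:
  assumes "smooth_0pi f" "\<theta> \<in> {0..pi}"
  shows "(f has_vector_derivative dth f \<theta>) (at \<theta> within {0..pi})"
proof -
  have "f differentiable (at \<theta> within {0..pi})"
    using assms unfolding smooth_0pi_def differentiable_on_def by (metis funpow_0)
  then show ?thesis
    by (simp add: dth_def vector_derivative_works)
qed

lemma smooth_0pi_continuous_on:
  assumes "smooth_0pi f"
  shows "continuous_on {0..pi} f" "continuous_on {0..pi} (dth f)"
proof -
  have "(dth ^^ 0) f differentiable_on {0..pi}" "(dth ^^ 1) f differentiable_on {0..pi}"
    using assms unfolding smooth_0pi_def by blast+
  then show "continuous_on {0..pi} f" "continuous_on {0..pi} (dth f)"
    by (auto dest: differentiable_imp_continuous_on)
qed

text \<open>The sequence \<open>h\<close> lists candidates for the iterated derivatives. By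
  induction \<open>(dth ^^ n) (h 0)\<close> agrees with \<open>h n\<close>, but only on the
  interval, so each derivative is carried over by a transformation within it.\<close>

lemma smooth_0piI:
  assumes h: "\<And>n \<theta>. \<theta> \<in> {0..pi} \<Longrightarrow> (h n has_vector_derivative h (Suc n) \<theta>) (at \<theta> within {0..pi})"
  shows "smooth_0pi (h 0)"
proof -
  have D: "(f has_vector_derivative h (Suc n) \<theta>) (at \<theta> within {0..pi})"
    if "\<And>t. t \<in> {0..pi} \<Longrightarrow> f t = h n t" "\<theta> \<in> {0..pi}" for f n \<theta>
    using that(2) that(1) h[OF that(2)] by (rule has_vector_derivative_transform)
  have eq: "(dth ^^ n) (h 0) \<theta> = h n \<theta>" if "\<theta> \<in> {0..pi}" for n \<theta>
    using that
  proof (induction n arbitrary: \<theta>)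
    case (Suc n)
    from dth_eqI[OF D[OF Suc.IH] Suc.prems] Suc.prems show ?case by simp
  qed simp
  show ?thesis
    unfolding smooth_0pi_def differentiable_on_def
    using D[OF eq] by (blast intro: differentiableI_vector)
qed

text \<open>Differentiation multiplies by \<open>k\<close> and advances the phase by a quarter
  period, which gives all derivatives in closed form. The free phase \<open>p\<close> covers the
  sine as well.\<close>

lemma smooth_0pi_cos: "smooth_0pi (\<lambda>\<theta>. a * cos (k * \<theta> + p))"
proof -
  define h where "h n \<theta> = a * k ^ n * cos (k * \<theta> + p + real n * (pi / 2))" for n \<theta>
  have shift: "cos (x + (pi + y) / 2) = - sin (x + y / 2)" for x y :: real
    using minus_sin_cos_eq[of "x + y / 2"] by (simp add: add_divide_distrib algebra_simps)
  have "(h n has_real_derivative h (Suc n) \<theta>) (at \<theta> within {0..pi})" for n \<theta>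
    unfolding h_def
    by (auto intro!: derivative_eq_intros simp: shift distrib_right)
  then have "smooth_0pi (h 0)"
    by (intro smooth_0piI) (simp add: has_real_derivative_iff_has_vector_derivative)
  then show ?thesis
    by (simp add: h_def[abs_def])
qed

text \<open>The zeros of \<open>sin\<close> at both endpoints are simple, so l'Hopital gives limits
  for \<open>f / sin\<close> there; these limits are the endpoint values of
  \<open>q\<close>.\<close>

lemma sin_factor:
  assumes f: "smooth_0pi f" "f 0 = 0" "f pi = 0"
  obtains q where "continuous_on {0..pi} q" "\<And>\<theta>. \<theta> \<in> {0..pi} \<Longrightarrow> f \<theta> = sin \<theta> * q \<theta>"
proof
  define q where "q \<theta> = (if \<theta> \<in> {0, pi} then dth f \<theta> / cos \<theta> else f \<theta> / sin \<theta>)" for \<theta>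
  have D: "(f has_real_derivative dth f \<theta>) (at \<theta> within {0..pi})" if "\<theta> \<in> {0..pi}" for \<theta>
    using smooth_0pi_has_vector_derivative[OF f(1) that]
    by (simp add: has_real_derivative_iff_has_vector_derivative)
  have ne: "sin \<theta> \<noteq> 0" if "\<theta> \<in> {0..pi}" "\<theta> \<notin> {0, pi}" for \<theta>
    using sin_gt_zero[of \<theta>] that by auto
  have "(q \<longlongrightarrow> q \<theta>) (at \<theta> within {0..pi})" if \<theta>: "\<theta> \<in> {0..pi}" for \<theta>
  proof -
    have "((\<lambda>t. f t / sin t) \<longlongrightarrow> q \<theta>) (at \<theta> within {0..pi})"
    proof (cases "\<theta> \<in> {0, pi}")
      case True
      then have "((\<lambda>t. f t / sin t) \<longlongrightarrow> dth f \<theta> / cos \<theta>) (at \<theta> within {0..pi})"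
        using f by (intro tendsto_quotient_of_zeros D \<theta>) (auto intro!: derivative_eq_intros)
      with True show ?thesis by (simp only: q_def if_True)
    next
      case False
      have "(f \<longlongrightarrow> f \<theta>) (at \<theta> within {0..pi})"
        using smooth_0pi_continuous_on(1)[OF f(1)] \<theta> by (simp add: continuous_on_def)
      with False show ?thesis
        unfolding q_def if_not_P[OF False] by (intro tendsto_intros ne \<theta>) auto
    qed
    \<comment> \<open>The limit uses a punctured neighbourhood, which can be shrunk to avoid both
      poles even if \<theta> is one of them; there \<open>q\<close> is the plain quotient.\<close>
    moreover have "\<forall>\<^sub>F t in at \<theta> within {0..pi}. f t / sin t = q t"
    proof -
      have "\<forall>\<^sub>F t in at \<theta> within {0..pi}. t \<noteq> p" for p
        using t1_space_nhds[of \<theta> p] by (cases "\<theta> = p") (auto simp: eventually_at_filter elim: eventually_mono)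
      from this[of 0] this[of pi] show ?thesis
        by eventually_elim (simp add: q_def)
    qed
    ultimately show ?thesis
      by (rule Lim_transform_eventually)
  qed
  then show "continuous_on {0..pi} q"
    by (simp add: continuous_on_def)
  show "f \<theta> = sin \<theta> * q \<theta>" if "\<theta> \<in> {0..pi}" for \<theta>
    using f ne[OF that] by (auto simp: q_def)
qed

section \<open>The density as a function of the squared parameter\<close>

text \<open>
  The density at \<open>(\<epsilon> \<xi>, \<epsilon> \<zeta>)\<close> with \<open>s = \<epsilon>\<^sup>2\<close>, \<open>S = sin \<theta>\<close>, \<open>A = r\<^sup>2 \<xi>\<^sup>2 + \<zeta>\<^sup>2\<close>, \<open>B = \<eta>\<^sup>2\<close>, \<open>L = \<zeta>\<^sup>2\<close>;
  \<open>P\<close>, \<open>Q\<close>, \<open>W\<close> come from the terms containing \<open>\<xi>'\<close> or \<open>\<zeta>'\<close>. Negative \<open>s\<close> is allowed, so that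
  \<open>s = 0\<close> is an interior point.
\<close>

definition even_dens :: "real \<Rightarrow> real \<Rightarrow> real \<Rightarrow> real \<Rightarrow> real \<Rightarrow> real \<Rightarrow> real \<Rightarrow> real \<Rightarrow> real \<Rightarrow> real" where
  "even_dens r S A B L P Q W s =
    - (2 * S * sqrt (r\<^sup>2 + s * A)) + S * (2 * r\<^sup>2 + s * B) / sqrt (r\<^sup>2 + s * B)
    + s * P / sqrt (r\<^sup>2 + s * A) + s * Q / ((r\<^sup>2 + s * L) * sqrt (r\<^sup>2 + s * B))
    - s\<^sup>2 * W / ((r\<^sup>2 + s * L) * sqrt (r\<^sup>2 + s * A))"

text \<open>Left unsimplified, each summand in the shape that the quotient and product rules
  produce, so that the derivative follows by applying these rules without rearrangement.\<close>

definition even_dens' :: "real \<Rightarrow> real \<Rightarrow> real \<Rightarrow> real \<Rightarrow> real \<Rightarrow> real \<Rightarrow> real \<Rightarrow> real \<Rightarrow> real \<Rightarrow> real" where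
  "even_dens' r S A B L P Q W s =
    (let a = sqrt (r\<^sup>2 + s * A); b = sqrt (r\<^sup>2 + s * B); l = r\<^sup>2 + s * L in
      - (2 * S * (A / (2 * a))) + (S * B / b - S * (2 * r\<^sup>2 + s * B) * (B / (2 * b)) / b\<^sup>2)
      + (P / a - s * P * (A / (2 * a)) / a\<^sup>2)
      + (Q / (l * b) - s * Q * (L * b + B / (2 * b) * l) / (l * b)\<^sup>2)
      - (2 * s * W / (l * a) - s\<^sup>2 * W * (L * a + A / (2 * a) * l) / (l * a)\<^sup>2))"

lemma has_real_derivative_even_dens:
  assumes "r\<^sup>2 + s * A > 0" "r\<^sup>2 + s * B > 0" "r\<^sup>2 + s * L > 0"
  shows "(even_dens r S A B L P Q W has_real_derivative even_dens' r S A B L P Q W s) (at s within U)"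
proof -
  have sq: "((\<lambda>s. sqrt (r\<^sup>2 + s * A)) has_real_derivative A / (2 * sqrt (r\<^sup>2 + s * A))) (at s within U)"
    if "r\<^sup>2 + s * A > 0" for A
    using that by (auto intro!: derivative_eq_intros simp: field_simps)
  note a = sq[OF assms(1)] and b = sq[OF assms(2)]
  have l: "((\<lambda>s. r\<^sup>2 + s * L) has_real_derivative L) (at s within U)"
    by (auto intro!: derivative_eq_intros)
  have ne: "sqrt (r\<^sup>2 + s * A) \<noteq> 0" "sqrt (r\<^sup>2 + s * B) \<noteq> 0" "r\<^sup>2 + s * L \<noteq> 0"
    using assms by auto
  have quot: "((\<lambda>s. f s / g s) has_real_derivative f' / g s - f s * g' / (g s)\<^sup>2) (at s within U)"
    if "(f has_real_derivative f') (at s within U)" "(g has_real_derivative g') (at s within U)" "g s \<noteq> 0"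
    for f g f' g'
    using DERIV_divide[OF that] that(3) by (simp add: diff_divide_distrib power2_eq_square)
  note la = DERIV_mult[OF l a] and lb = DERIV_mult[OF l b]
  have num: "((\<lambda>s. s * C) has_real_derivative C) (at s within U)"
    "((\<lambda>s. s\<^sup>2 * C) has_real_derivative 2 * s * C) (at s within U)"
    "((\<lambda>s. S * (2 * r\<^sup>2 + s * C)) has_real_derivative S * C) (at s within U)" for C
    by (auto intro!: derivative_eq_intros)
  have "l * a \<noteq> 0" if "l \<noteq> 0" "a \<noteq> 0" for l a :: real
    using that by simp
  note ne' = this[OF ne(3) ne(1)] this[OF ne(3) ne(2)]
  show ?thesis
    unfolding even_dens_def[abs_def] even_dens'_def Let_def
    by (intro DERIV_add DERIV_diff DERIV_minus DERIV_cmult[OF a] quot[OF num(3) b ne(2)] quot[OF num(1) a ne(1)]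
        quot[OF num(1) lb ne'(2)] quot[OF num(2) la ne'(1)])
qed

text \<open>\<open>B\<close> drops out because \<open>(2 * r^2 + u) / sqrt (r^2 + u)\<close> is
  stationary at \<open>u = 0\<close>, and \<open>W\<close> because its term is quadratic in
  \<open>s\<close>. Hence the second variation contains no \<eta>.\<close>

lemma even_dens'_0:
  assumes "r > 0"
  shows "even_dens' r S A B L P Q W 0 = - (S * A / r) + P / r + Q / r ^ 3"
  using assms by (simp add: even_dens'_def Let_def power2_eq_square power3_eq_cube field_simps)

text \<open>The domain is an arbitrary topological space in order to serve both for \<theta> alone
  with \<open>s\<close> fixed and for pairs of \<open>s\<close> and \<theta>.\<close>

lemma continuous_on_even_dens:
  fixes A B L P Q W S s :: "'a::topological_space \<Rightarrow> real"
  assumes "continuous_on U S" "continuous_on U A" "continuous_on U B" "continuous_on U L"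
    "continuous_on U P" "continuous_on U Q" "continuous_on U W" "continuous_on U s"
    and pos: "\<And>x. x \<in> U \<Longrightarrow> r\<^sup>2 + s x * A x > 0" "\<And>x. x \<in> U \<Longrightarrow> r\<^sup>2 + s x * B x > 0"
      "\<And>x. x \<in> U \<Longrightarrow> r\<^sup>2 + s x * L x > 0"
  shows "continuous_on U (\<lambda>x. even_dens' r (S x) (A x) (B x) (L x) (P x) (Q x) (W x) (s x))"
    and "continuous_on U (\<lambda>x. even_dens r (S x) (A x) (B x) (L x) (P x) (Q x) (W x) (s x))"
proof -
  have ne: "sqrt (r\<^sup>2 + s x * A x) \<noteq> 0" "sqrt (r\<^sup>2 + s x * B x) \<noteq> 0" "r\<^sup>2 + s x * L x \<noteq> 0"
    if "x \<in> U" for x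
    using pos[OF that] by auto
  have prod: "l * a \<noteq> 0" "(l * a)\<^sup>2 \<noteq> 0" if "l \<noteq> 0" "a \<noteq> 0" for l a :: real
    using that by auto
  have sq: "a\<^sup>2 \<noteq> 0" "2 * a \<noteq> 0" if "a \<noteq> 0" for a :: real
    using that by auto
  note c = assms(1-8)
  have l: "continuous_on U (\<lambda>x. r\<^sup>2 + s x * L x)"
    and a: "continuous_on U (\<lambda>x. sqrt (r\<^sup>2 + s x * A x))"
    and b: "continuous_on U (\<lambda>x. sqrt (r\<^sup>2 + s x * B x))"
    by (intro continuous_on_real_sqrt continuous_on_add continuous_on_mult continuous_on_const c)+
  note rules = continuous_on_add continuous_on_diff continuous_on_minus continuous_on_mult
    continuous_on_divide continuous_on_power continuous_on_const c l a b
  show "continuous_on U (\<lambda>x. even_dens' r (S x) (A x) (B x) (L x) (P x) (Q x) (W x) (s x))"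
    unfolding even_dens'_def Let_def
    by (rule rules | rule ballI, (rule sq prod ne | assumption)+)+
  show "continuous_on U (\<lambda>x. even_dens r (S x) (A x) (B x) (L x) (P x) (Q x) (W x) (s x))"
    unfolding even_dens_def
    by (rule rules | rule ballI, (rule prod ne | assumption)+)+
qed

section \<open>The energy density of Minkowski spacetime\<close>

lemma minkowski_derivs:
  "deriv (cH minkowski r) = (\<lambda>\<theta>. 2 * r\<^sup>2 * sin \<theta> * cos \<theta>)"
  "deriv (deriv (cH minkowski r)) \<theta> = 2 * r\<^sup>2 * ((cos \<theta>)\<^sup>2 - (sin \<theta>)\<^sup>2)"
  "deriv (cR minkowski r) \<theta> = 0" "deriv (cS minkowski r) \<theta> = 0"
  "deriv (\<lambda>\<rho>. cH minkowski \<rho> \<theta> * (cS minkowski \<rho> \<theta>)\<^sup>2) r = 4 * r ^ 3 * (sin \<theta>)\<^sup>2"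
proof -
  show *: "deriv (cH minkowski r) = (\<lambda>\<theta>. 2 * r\<^sup>2 * sin \<theta> * cos \<theta>)"
    by (auto simp: minkowski_def intro!: ext DERIV_imp_deriv derivative_eq_intros)
  show "deriv (deriv (cH minkowski r)) \<theta> = 2 * r\<^sup>2 * ((cos \<theta>)\<^sup>2 - (sin \<theta>)\<^sup>2)"
    unfolding * by (rule DERIV_imp_deriv) (auto intro!: derivative_eq_intros simp: power2_eq_square algebra_simps)
  show "deriv (cR minkowski r) \<theta> = 0" "deriv (cS minkowski r) \<theta> = 0"
    by (simp_all add: minkowski_def)
  show "deriv (\<lambda>\<rho>. cH minkowski \<rho> \<theta> * (cS minkowski \<rho> \<theta>)\<^sup>2) r = 4 * r ^ 3 * (sin \<theta>)\<^sup>2"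
    unfolding minkowski_def spacetime_metric.simps
    by (rule DERIV_imp_deriv)
      (auto intro!: derivative_eq_intros simp: power2_eq_square power3_eq_cube algebra_simps)
qed

text \<open>Substituting \<open>y = sin \<theta> * q\<close> makes both \<beta> and the numerator
  \<open>H_\<theta>\<theta> - 2 l\<close> multiples of \<open>(sin \<theta>)^2\<close>, so the
  singular factor cancels. The terms with \<open>R_\<theta>\<close> and \<open>S_\<theta>\<close>
  vanish.\<close>

lemma energy_density_minkowski:
  fixes x y :: "real \<Rightarrow> real"
  assumes r: "r > 0" and S: "sin \<theta> > 0" and Y: "y \<theta> = sin \<theta> * q"
  defines "a \<equiv> sqrt (r\<^sup>2 + (r\<^sup>2 * (x \<theta>)\<^sup>2 + (y \<theta>)\<^sup>2))" and "b \<equiv> sqrt (r\<^sup>2 + q\<^sup>2)"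
    and "l \<equiv> r\<^sup>2 + (y \<theta>)\<^sup>2"
  shows "energy_density minkowski r x y \<theta> =
    - (2 * sin \<theta> * a) + sin \<theta> * (2 * r\<^sup>2 + q\<^sup>2) / b + r * sin \<theta> * y \<theta> * dth x \<theta> / a
    + r\<^sup>2 * cos \<theta> * y \<theta> * dth y \<theta> / (l * b) - r * sin \<theta> * x \<theta> * (y \<theta>)\<^sup>2 * dth y \<theta> / (l * a)"
proof -
  have pos: "a > 0" "b > 0" "l > 0"
    using \<open>r > 0\<close> by (auto simp: a_def b_def l_def intro!: add_pos_nonneg)
  have l: "(y \<theta>)\<^sup>2 + r\<^sup>2 = l"
    by (simp add: l_def)
  have \<alpha>: "sqrt ((x \<theta>)\<^sup>2 * r\<^sup>2 + 1\<^sup>2 * l) = a"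
    by (simp add: a_def l_def algebra_simps)
  have H: "sqrt (r\<^sup>2 * (sin \<theta>)\<^sup>2) = r * sin \<theta>"
    using assms by (simp add: real_sqrt_mult)
  \<comment> \<open>With \<open>1 - (cos \<theta>)^2 = (sin \<theta>)^2\<close> the radicand of
    \<beta> gains the factor \<open>(sin \<theta>)^4\<close>.\<close>
  have "- ((2 * r\<^sup>2 * sin \<theta> * cos \<theta>)\<^sup>2) + 4 * (r\<^sup>2 * (sin \<theta>)\<^sup>2) * l = (2 * r * (sin \<theta>)\<^sup>2)\<^sup>2 * (r\<^sup>2 + q\<^sup>2)"
    unfolding l_def Y power_mult_distrib cos_squared_eq by algebra
  then have \<beta>: "sqrt (- ((2 * r\<^sup>2 * sin \<theta> * cos \<theta>)\<^sup>2) + 4 * (r\<^sup>2 * (sin \<theta>)\<^sup>2) * l) = 2 * r * (sin \<theta>)\<^sup>2 * b"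
    using assms by (simp add: real_sqrt_mult b_def)
  have 1: "a * (4 * r ^ 3 * (sin \<theta>)\<^sup>2) / (2 * (r * sin \<theta>) * 1\<^sup>2 * r\<^sup>2) = 2 * sin \<theta> * a"
    using r S by (simp add: field_simps power2_eq_square power3_eq_cube)
  have *: "(2 * r\<^sup>2 * ((cos \<theta>)\<^sup>2 - (sin \<theta>)\<^sup>2) - 2 * l) = - (2 * (sin \<theta>)\<^sup>2 * (2 * r\<^sup>2 + q\<^sup>2))"
    unfolding l_def Y power_mult_distrib cos_squared_eq by algebra
  have 2: "r * sin \<theta> * ((2 * r\<^sup>2 * ((cos \<theta>)\<^sup>2 - (sin \<theta>)\<^sup>2) - 2 * l) / (2 * r * (sin \<theta>)\<^sup>2 * b))
      = - (sin \<theta> * (2 * r\<^sup>2 + q\<^sup>2) / b)"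
    unfolding * using r S pos(2) by (simp add: field_simps power2_eq_square)
  have 3: "r * sin \<theta> * y \<theta> * (2 * r\<^sup>2 * sin \<theta> * cos \<theta> * a - x \<theta> * y \<theta> * (2 * r * (sin \<theta>)\<^sup>2 * b))
       / (l * a * (2 * r * (sin \<theta>)\<^sup>2 * b)) * dth y \<theta>
     = r\<^sup>2 * cos \<theta> * y \<theta> * dth y \<theta> / (l * b) - r * sin \<theta> * x \<theta> * (y \<theta>)\<^sup>2 * dth y \<theta> / (l * a)"
    using r S pos by (simp add: field_simps power2_eq_square)
  have coeffs: "cH minkowski r \<theta> = r\<^sup>2 * (sin \<theta>)\<^sup>2" "cR minkowski r \<theta> = 1" "cS minkowski r \<theta> = r"
    by (simp_all add: minkowski_def)
  show ?thesis
    \<comment> \<open>The second derivative of \<open>H\<close> is rewritten before the first, which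
      occurs inside it.\<close>
    unfolding energy_density_def Let_def minkowski_derivs(2-5)
    unfolding minkowski_derivs(1) coeffs l \<alpha> H \<beta> 1 3 mult_zero_left mult_zero_right div_0 add_0_right diff_zero
      2 by simp
qed

section \<open>First and second variation of the energy\<close>

text \<open>The chain rule gives \<open>E' \<epsilon> = \<epsilon> * G' (\<epsilon>^2) / 2\<close>.
  This vanishes at 0, and its difference quotient there is \<open>G' (\<epsilon>^2) / 2\<close>, so
  continuity of \<open>G'\<close> at 0 yields the second derivative.\<close>

lemma variation_of_even_function:
  assumes "\<delta> > 0" and G: "\<And>s. \<bar>s\<bar> < \<delta> \<Longrightarrow> (G has_real_derivative G' s) (at s)" and G': "isCont G' 0"
    and E: "\<And>\<epsilon>. E \<epsilon> = 1 / 4 * G (\<epsilon>\<^sup>2)"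
  shows "(E has_real_derivative 0) (at 0)"
    and "\<forall>\<^sub>F \<epsilon> in nhds 0. E field_differentiable at \<epsilon>"
    and "(deriv E has_real_derivative G' 0 / 2) (at 0)"
proof -
  have D: "(E has_real_derivative \<epsilon> * G' (\<epsilon>\<^sup>2) / 2) (at \<epsilon>)" if "\<epsilon>\<^sup>2 < \<delta>" for \<epsilon>
  proof -
    have "((\<lambda>\<epsilon>. 1 / 4 * G (\<epsilon>\<^sup>2)) has_real_derivative 1 / 4 * (G' (\<epsilon>\<^sup>2) * (2 * \<epsilon>))) (at \<epsilon>)"
      using that by (intro DERIV_cmult DERIV_chain2[OF G]) (auto intro!: derivative_eq_intros)
    then show ?thesis
      by (simp add: E[abs_def] mult.commute)
  qed
  show "(E has_real_derivative 0) (at 0)"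
    using D[of 0] \<open>\<delta> > 0\<close> by simp
  have "((\<lambda>\<epsilon>::real. \<epsilon>\<^sup>2) \<longlongrightarrow> 0\<^sup>2) (nhds 0)"
    by (intro tendsto_power filterlim_ident)
  then have small: "\<forall>\<^sub>F \<epsilon>::real in nhds 0. \<epsilon>\<^sup>2 < \<delta>"
    by (rule order_tendstoD(2)) (simp add: \<open>\<delta> > 0\<close>)
  then show "\<forall>\<^sub>F \<epsilon> in nhds 0. E field_differentiable at \<epsilon>"
    by eventually_elim (auto dest: D simp: field_differentiable_def)
  from small have ev: "\<forall>\<^sub>F \<epsilon> in nhds 0. deriv E \<epsilon> = \<epsilon> * G' (\<epsilon>\<^sup>2) / 2"
    by eventually_elim (rule DERIV_imp_deriv[OF D])
  have "((\<lambda>\<epsilon>. \<epsilon> * G' (\<epsilon>\<^sup>2) / 2) has_real_derivative G' 0 / 2) (at 0)"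
  proof -
    have "isCont (\<lambda>\<epsilon>. G' (\<epsilon>\<^sup>2) / 2) 0"
      using G' by (intro continuous_intros isCont_o2[of 0 "\<lambda>\<epsilon>. \<epsilon>\<^sup>2" G']) auto
    then have "((\<lambda>h. G' (h\<^sup>2) / 2) \<longlongrightarrow> G' 0 / 2) (at 0)"
      by (simp add: isCont_def)
    moreover have "\<forall>\<^sub>F h in at 0. G' (h\<^sup>2) / 2 = ((0 + h) * G' ((0 + h)\<^sup>2) / 2 - 0 * G' (0\<^sup>2) / 2) / h"
      by (auto simp: eventually_at_filter intro!: always_eventually)
    ultimately show ?thesis
      unfolding DERIV_def by (rule Lim_transform_eventually)
  qed
  then show "(deriv E has_real_derivative G' 0 / 2) (at 0)"
    by (rule DERIV_cong_ev[OF refl ev refl, THEN iffD2])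
qed

lemma energy_variation:
  assumes "r > 0" "admissible \<xi> \<zeta>"
  shows "(along (energy minkowski r) (\<lambda>\<theta>. 0) (\<lambda>\<theta>. 0) \<xi> \<zeta> has_real_derivative 0) (at 0)" (is ?crit)
    and "has_second_variation (energy minkowski r) (\<lambda>\<theta>. 0) (\<lambda>\<theta>. 0) \<xi> \<zeta>
      (1 / 2 * integral {0..pi} (\<lambda>\<theta>. - (sin \<theta> * (r * (\<xi> \<theta>)\<^sup>2 + (\<zeta> \<theta>)\<^sup>2 / r))
        + sin \<theta> * \<zeta> \<theta> * dth \<xi> \<theta> + cos \<theta> * \<zeta> \<theta> * dth \<zeta> \<theta> / r))" (is ?second)
proof -
  have sm: "smooth_0pi \<xi>" "smooth_0pi \<zeta>" and \<zeta>0: "\<zeta> 0 = 0" "\<zeta> pi = 0"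
    using assms(2) by (auto simp: admissible_def)
  from sin_factor[OF sm(2) \<zeta>0] obtain \<eta>
    where \<eta>: "continuous_on {0..pi} \<eta>" "\<And>\<theta>. \<theta> \<in> {0..pi} \<Longrightarrow> \<zeta> \<theta> = sin \<theta> * \<eta> \<theta>"
    by blast
  note cont = smooth_0pi_continuous_on[OF sm(1)] smooth_0pi_continuous_on[OF sm(2)] \<eta>(1)
  define A where "A \<theta> = r\<^sup>2 * (\<xi> \<theta>)\<^sup>2 + (\<zeta> \<theta>)\<^sup>2" for \<theta>
  define B where "B \<theta> = (\<eta> \<theta>)\<^sup>2" for \<theta>
  define L where "L \<theta> = (\<zeta> \<theta>)\<^sup>2" for \<theta>
  define P where "P \<theta> = r * sin \<theta> * \<zeta> \<theta> * dth \<xi> \<theta>" for \<theta>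
  define Q where "Q \<theta> = r\<^sup>2 * cos \<theta> * \<zeta> \<theta> * dth \<zeta> \<theta>" for \<theta>
  define W where "W \<theta> = r * sin \<theta> * \<xi> \<theta> * (\<zeta> \<theta>)\<^sup>2 * dth \<zeta> \<theta>" for \<theta>
  define \<Phi> where "\<Phi> s \<theta> = even_dens r (sin \<theta>) (A \<theta>) (B \<theta>) (L \<theta>) (P \<theta>) (Q \<theta>) (W \<theta>) s" for s \<theta>
  define \<Phi>' where "\<Phi>' s \<theta> = even_dens' r (sin \<theta>) (A \<theta>) (B \<theta>) (L \<theta>) (P \<theta>) (Q \<theta>) (W \<theta>) s" for s \<theta>
  have cABL: "continuous_on {0..pi} A" "continuous_on {0..pi} B" "continuous_on {0..pi} L"
    "continuous_on {0..pi} P" "continuous_on {0..pi} Q" "continuous_on {0..pi} W"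
    "continuous_on {0..pi} (sin :: real \<Rightarrow> real)"
    unfolding A_def B_def L_def P_def Q_def W_def by (intro continuous_intros cont)+
  \<comment> \<open>A single bound \<open>M\<close> for the three nonnegative coefficients makes
    \<open>\<delta> = r^2 / M\<close> small enough, uniformly in \<theta>, to keep
    \<open>r^2 + s * A\<close>, \<open>r^2 + s * B\<close> and \<open>r^2 + s * L\<close> positive
    even for negative \<open>s\<close>.\<close>
  have "continuous_on {0..pi} (\<lambda>\<theta>. A \<theta> + B \<theta> + L \<theta>)"
    by (intro continuous_intros cABL)
  then have "bounded ((\<lambda>\<theta>. A \<theta> + B \<theta> + L \<theta>) ` {0..pi})"
    by (intro compact_imp_bounded compact_continuous_image) auto
  then obtain M where M: "M > 0" "\<And>\<theta>. \<theta> \<in> {0..pi} \<Longrightarrow> A \<theta> + B \<theta> + L \<theta> \<le> M"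
    unfolding bounded_pos by (auto simp: abs_le_iff)
  define \<delta> where "\<delta> = r\<^sup>2 / M"
  have "\<delta> > 0"
    using M(1) \<open>r > 0\<close> by (simp add: \<delta>_def)
  have nonneg: "A \<theta> \<ge> 0" "B \<theta> \<ge> 0" "L \<theta> \<ge> 0" for \<theta>
    by (simp_all add: A_def B_def L_def)
  have gt: "r\<^sup>2 + s * C > 0" if "\<bar>s\<bar> < \<delta>" "0 \<le> C" "C \<le> M" for s C
  proof -
    have "\<bar>s * C\<bar> \<le> \<bar>s\<bar> * M"
      using that by (simp add: abs_mult mult_left_mono)
    also have "\<dots> < r\<^sup>2"
      using that(1) M(1) by (simp add: \<delta>_def field_simps)
    finally show ?thesis by linarith
  qed
  have pos: "r\<^sup>2 + s * A \<theta> > 0" "r\<^sup>2 + s * B \<theta> > 0" "r\<^sup>2 + s * L \<theta> > 0"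
    if "\<theta> \<in> {0..pi}" "\<bar>s\<bar> < \<delta>" for s \<theta>
    using gt[OF that(2)] M(2)[OF that(1)] nonneg[of \<theta>] by auto
  let ?U = "{-\<delta><..<\<delta>}"
  have c2: "continuous_on (?U \<times> {0..pi}) (\<lambda>z. f (snd z))" if "continuous_on {0..pi} f" for f :: "real \<Rightarrow> real"
    using that by (rule continuous_on_compose2) (auto intro: continuous_intros)
  \<comment> \<open>Joint continuity is used twice: for differentiation under the integral sign and
    for the continuity of \<open>G'\<close>.\<close>
  have cont': "continuous_on (?U \<times> cbox 0 pi) (\<lambda>(s, \<theta>). \<Phi>' s \<theta>)"
    unfolding \<Phi>'_def split_beta
    by (intro continuous_on_even_dens c2[simplified cbox_interval[symmetric]] cABL[simplified cbox_interval[symmetric]]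
        continuous_on_fst continuous_on_id pos) auto
  have integrable: "\<Phi> s integrable_on cbox 0 pi" if "\<bar>s\<bar> < \<delta>" for s
    unfolding \<Phi>_def
    using pos that by (intro integrable_continuous continuous_on_even_dens continuous_on_const) (auto intro: cABL)
  define G where "G s = integral {0..pi} (\<Phi> s)" for s
  define G' where "G' s = integral {0..pi} (\<Phi>' s)" for s
  have G: "(G has_real_derivative G' s) (at s)" if "\<bar>s\<bar> < \<delta>" for s
  proof -
    have "((\<lambda>s. integral (cbox 0 pi) (\<Phi> s)) has_field_derivative integral (cbox 0 pi) (\<Phi>' s)) (at s within ?U)"
    proof (rule leibniz_rule_field_derivative[OF _ _ cont'])
      show "((\<lambda>s. \<Phi> s \<theta>) has_real_derivative \<Phi>' s \<theta>) (at s within ?U)"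
        if "s \<in> ?U" "\<theta> \<in> cbox 0 pi" for s \<theta>
        unfolding \<Phi>_def \<Phi>'_def using that by (intro has_real_derivative_even_dens pos) auto
    qed (use that integrable in auto)
    moreover have "at s within ?U = at s"
      using that by (intro at_within_open) auto
    ultimately show ?thesis
      by (simp add: G_def[abs_def] G'_def)
  qed
  have "continuous_on ?U G'"
    using integral_continuous_on_param[OF cont'] by (simp add: G'_def[abs_def])
  then have "isCont G' 0"
    using \<open>\<delta> > 0\<close> by (simp add: continuous_on_eq_continuous_at)
  have E: "along (energy minkowski r) (\<lambda>\<theta>. 0) (\<lambda>\<theta>. 0) \<xi> \<zeta> \<epsilon> = 1 / 4 * G (\<epsilon>\<^sup>2)" for \<epsilon>
  proof -
    \<comment> \<open>The two poles, where the original density divides by zero, form a null set and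
      are discarded by \<open>integral_spike\<close>.\<close>
    have "energy_density minkowski r (\<lambda>\<theta>. \<epsilon> * \<xi> \<theta>) (\<lambda>\<theta>. \<epsilon> * \<zeta> \<theta>) \<theta> = \<Phi> (\<epsilon>\<^sup>2) \<theta>"
      if "\<theta> \<in> {0..pi} - {0, pi}" for \<theta>
    proof -
      have \<theta>: "\<theta> \<in> {0..pi}" "sin \<theta> > 0"
        using that by (auto intro!: sin_gt_zero)
      have d: "dth (\<lambda>\<theta>. \<epsilon> * f \<theta>) \<theta> = \<epsilon> * dth f \<theta>" if "smooth_0pi f" for f
        using smooth_0pi_has_vector_derivative[OF that \<theta>(1)]
        by (intro dth_eqI \<theta>(1) has_vector_derivative_mult_right)
      have y: "\<epsilon> * \<zeta> \<theta> = sin \<theta> * (\<epsilon> * \<eta> \<theta>)"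
        using \<eta>(2)[OF \<theta>(1)] by simp
      have l: "(\<epsilon> * \<zeta> \<theta>)\<^sup>2 = \<epsilon>\<^sup>2 * L \<theta>" and b: "(\<epsilon> * \<eta> \<theta>)\<^sup>2 = \<epsilon>\<^sup>2 * B \<theta>"
        by (simp_all add: L_def B_def power_mult_distrib)
      have a: "r\<^sup>2 * (\<epsilon> * \<xi> \<theta>)\<^sup>2 + \<epsilon>\<^sup>2 * L \<theta> = \<epsilon>\<^sup>2 * A \<theta>"
        by (simp add: A_def L_def power_mult_distrib algebra_simps)
      have p: "r * sin \<theta> * (\<epsilon> * \<zeta> \<theta>) * (\<epsilon> * dth \<xi> \<theta>) = \<epsilon>\<^sup>2 * P \<theta>"
        and q: "r\<^sup>2 * cos \<theta> * (\<epsilon> * \<zeta> \<theta>) * (\<epsilon> * dth \<zeta> \<theta>) = \<epsilon>\<^sup>2 * Q \<theta>"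
        \<comment> \<open>This term is quartic in the variation, hence of order
          \<open>s^2\<close>.\<close>
        and w: "r * sin \<theta> * (\<epsilon> * \<xi> \<theta>) * (\<epsilon>\<^sup>2 * L \<theta>) * (\<epsilon> * dth \<zeta> \<theta>) = (\<epsilon>\<^sup>2)\<^sup>2 * W \<theta>"
        by (simp_all add: P_def Q_def W_def L_def power2_eq_square)
      show ?thesis
        unfolding energy_density_minkowski[OF \<open>r > 0\<close> \<theta>(2), of "\<lambda>\<theta>. \<epsilon> * \<zeta> \<theta>", OF y] d[OF sm(1)] d[OF sm(2)]
          \<Phi>_def even_dens_def
        by (simp only: l b a p q w)
    qed
    then have "integral {0..pi} (\<Phi> (\<epsilon>\<^sup>2)) = integral {0..pi} (energy_density minkowski r (\<lambda>\<theta>. \<epsilon> * \<xi> \<theta>) (\<lambda>\<theta>. \<epsilon> * \<zeta> \<theta>))"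
      by (intro integral_spike[of "{0, pi}"]) auto
    then show ?thesis
      by (simp add: along_def energy_def G_def)
  qed
  have "G' 0 = integral {0..pi} (\<lambda>\<theta>. - (sin \<theta> * (r * (\<xi> \<theta>)\<^sup>2 + (\<zeta> \<theta>)\<^sup>2 / r))
        + sin \<theta> * \<zeta> \<theta> * dth \<xi> \<theta> + cos \<theta> * \<zeta> \<theta> * dth \<zeta> \<theta> / r)"
    using \<open>r > 0\<close> unfolding G'_def \<Phi>'_def even_dens'_0[OF \<open>r > 0\<close>] A_def P_def Q_def
    by (intro integral_cong) (simp add: field_simps power2_eq_square power3_eq_cube)
  with variation_of_even_function[OF \<open>\<delta> > 0\<close> G \<open>isCont G' 0\<close> E] show ?crit ?second
    by (auto simp: has_second_variation_def)
qed

section \<open>Explicit variations of both signs\<close>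

text \<open>Integrality of the frequency \<open>k\<close> makes \<open>sin (k * \<theta>)\<close>
  vanish at both endpoints, which gives the boundary conditions for both functions.\<close>

lemma admissible_cos_sin:
  "admissible (\<lambda>\<theta>. a * cos (real k * \<theta>)) (\<lambda>\<theta>. b * sin (real k * \<theta>))"
  and dth_cos: "\<theta> \<in> {0..pi} \<Longrightarrow> dth (\<lambda>\<theta>. a * cos (real k * \<theta>)) \<theta> = - (a * real k * sin (real k * \<theta>))"
  and dth_sin: "\<theta> \<in> {0..pi} \<Longrightarrow> dth (\<lambda>\<theta>. b * sin (real k * \<theta>)) \<theta> = b * real k * cos (real k * \<theta>)"
proof -
  show cos: "dth (\<lambda>\<theta>. a * cos (real k * \<theta>)) \<theta> = - (a * real k * sin (real k * \<theta>))" if "\<theta> \<in> {0..pi}" for \<theta>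
    by (intro dth_eqI that)
      (auto intro!: derivative_eq_intros simp: has_real_derivative_iff_has_vector_derivative[symmetric])
  show "dth (\<lambda>\<theta>. b * sin (real k * \<theta>)) \<theta> = b * real k * cos (real k * \<theta>)" if "\<theta> \<in> {0..pi}"
    by (intro dth_eqI that)
      (auto intro!: derivative_eq_intros simp: has_real_derivative_iff_has_vector_derivative[symmetric])
  have "smooth_0pi (\<lambda>\<theta>. b * sin (real k * \<theta>))"
    using smooth_0pi_cos[of b "real k" "- (pi / 2)"] by (simp add: cos_diff)
  then show "admissible (\<lambda>\<theta>. a * cos (real k * \<theta>)) (\<lambda>\<theta>. b * sin (real k * \<theta>))"
    using smooth_0pi_cos[of a "real k" 0] cos by (auto simp: admissible_def)
qed

text \<open>With \<open>\<zeta> = 0\<close> only \<open>- r * sin \<theta> * \<xi>^2\<close>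
  survives, which is nonpositive; the constant \<open>\<xi> = 1\<close> is the simplest
  choice.\<close>

lemma second_variation_neg:
  assumes "r > 0"
  shows "has_second_variation (energy minkowski r) (\<lambda>\<theta>. 0) (\<lambda>\<theta>. 0) (\<lambda>\<theta>. 1) (\<lambda>\<theta>. 0) (- r)"
proof -
  have adm: "admissible (\<lambda>\<theta>. 1) (\<lambda>\<theta>. 0)"
    using admissible_cos_sin[of 1 0 0] by simp
  have "((\<lambda>\<theta>. - (sin \<theta> * r)) has_integral r * cos pi - r * cos 0) {0..pi}"
    by (intro fundamental_theorem_of_calculus)
      (auto intro!: derivative_eq_intros simp: has_real_derivative_iff_has_vector_derivative[symmetric])
  then have "integral {0..pi} (\<lambda>\<theta>. - (sin \<theta> * r)) = - 2 * r"
    by (simp add: integral_unique)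
  then show ?thesis
    using energy_variation(2)[OF assms adm] by simp
qed

text \<open>Integrating \<open>cos \<theta> * \<zeta> * \<zeta>' / r\<close> by parts turns the
  integrand into \<open>sin \<theta> * (\<zeta> * \<xi>' - \<zeta>^2 / (2 * r) - r *
  \<xi>^2)\<close>. For given \<xi> it is largest at \<open>\<zeta> = r * \<xi>'\<close>, with value
  \<open>r * sin \<theta> * (\<xi>'^2 / 2 - \<xi>^2)\<close>. The choice
  \<open>\<xi> = - cos \<theta>\<close> gives integral 0; doubling the frequency makes it
  positive.\<close>

lemma second_variation_pos:
  assumes "r > 0"
  shows "has_second_variation (energy minkowski r) (\<lambda>\<theta>. 0) (\<lambda>\<theta>. 0)
    (\<lambda>\<theta>. - 1 * cos (real 2 * \<theta>)) (\<lambda>\<theta>. 2 * r * sin (real 2 * \<theta>)) (1 / 2 * (6 / 5 * r))"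
proof -
  let ?\<xi> = "\<lambda>\<theta>. - 1 * cos (real 2 * \<theta>)" and ?\<zeta> = "\<lambda>\<theta>. 2 * r * sin (real 2 * \<theta>)"
  \<comment> \<open>An antiderivative in \<open>u = cos \<theta>\<close>; the leading minus sign
    comes from \<open>du = - sin \<theta> d\<theta>\<close>.\<close>
  define F where "F u = - r * (28 / 5 * u ^ 5 - 4 * u ^ 3 - u)" for u
  have "- (sin \<theta> * (r * (?\<xi> \<theta>)\<^sup>2 + (?\<zeta> \<theta>)\<^sup>2 / r)) + sin \<theta> * ?\<zeta> \<theta> * dth ?\<xi> \<theta> + cos \<theta> * ?\<zeta> \<theta> * dth ?\<zeta> \<theta> / r
      = r * (28 * cos \<theta> ^ 4 - 12 * (cos \<theta>)\<^sup>2 - 1) * sin \<theta>" if "\<theta> \<in> {0..pi}" for \<theta>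
  proof -
    \<comment> \<open>Since \<open>\<zeta> = r * \<xi>'\<close>, the terms
      \<open>- sin \<theta> * \<zeta>^2 / r\<close> and
      \<open>sin \<theta> * \<zeta> * \<xi>'\<close> cancel.\<close>
    have "- (sin \<theta> * (r * (- cos (2 * \<theta>))\<^sup>2 + (2 * r * sin (2 * \<theta>))\<^sup>2 / r))
        + sin \<theta> * (2 * r * sin (2 * \<theta>)) * (2 * sin (2 * \<theta>))
        + cos \<theta> * (2 * r * sin (2 * \<theta>)) * (4 * r * cos (2 * \<theta>)) / r
      = r * (- sin \<theta> * (cos (2 * \<theta>))\<^sup>2 + 8 * cos \<theta> * sin (2 * \<theta>) * cos (2 * \<theta>))"
      using assms by (simp add: field_simps power2_eq_square)
    also have "\<dots> = r * (28 * cos \<theta> ^ 4 - 12 * (cos \<theta>)\<^sup>2 - 1) * sin \<theta>"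
      unfolding cos_double_cos sin_double by algebra
    finally show ?thesis
      unfolding dth_cos[OF that] dth_sin[OF that] by simp
  qed
  then have "integral {0..pi} (\<lambda>\<theta>. - (sin \<theta> * (r * (?\<xi> \<theta>)\<^sup>2 + (?\<zeta> \<theta>)\<^sup>2 / r))
      + sin \<theta> * ?\<zeta> \<theta> * dth ?\<xi> \<theta> + cos \<theta> * ?\<zeta> \<theta> * dth ?\<zeta> \<theta> / r)
    = integral {0..pi} (\<lambda>\<theta>. r * (28 * cos \<theta> ^ 4 - 12 * (cos \<theta>)\<^sup>2 - 1) * sin \<theta>)"
    by (rule integral_cong)
  moreover have "((\<lambda>\<theta>. r * (28 * cos \<theta> ^ 4 - 12 * (cos \<theta>)\<^sup>2 - 1) * sin \<theta>) has_integral
      F (cos pi) - F (cos 0)) {0..pi}"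
    unfolding F_def
    by (intro fundamental_theorem_of_calculus)
      (auto intro!: derivative_eq_intros simp: has_real_derivative_iff_has_vector_derivative[symmetric] algebra_simps)
  moreover have "F (cos pi) - F (cos 0) = 6 / 5 * r"
    by (simp add: F_def)
  ultimately show ?thesis
    using energy_variation(2)[OF assms admissible_cos_sin[of "- 1" 2 "2 * r"]]
    by (simp only: integral_unique)
qed

theorem corollary3p2:
  fixes r\<^sub>0 :: real
  assumes "r\<^sub>0 > 0"
  shows "saddle_point (energy minkowski r\<^sub>0) (\<lambda>\<theta>. 0) (\<lambda>\<theta>. 0)"
  unfolding saddle_point_def critical_point_def
proof (intro conjI allI impI exI)
  \<comment> \<open>The existential witnesses are schematic: the facts shown here fix the negative
    direction and both values \<open>c\<close>. The positive direction is found by unification,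
    \<open>admissible_cos_sin\<close> leaving amplitudes and frequency open until
    \<open>second_variation_pos\<close> determines them.\<close>
  show "admissible (\<lambda>\<theta>. 0) (\<lambda>\<theta>. 0)" "admissible (\<lambda>\<theta>. 1) (\<lambda>\<theta>. 0)"
    using admissible_cos_sin[of 0 0 0] admissible_cos_sin[of 1 0 0] by simp_all
  show "- r\<^sub>0 < 0" "1 / 2 * (6 / 5 * r\<^sub>0) > 0"
    using assms by simp_all
qed (rule energy_variation second_variation_neg second_variation_pos admissible_cos_sin assms | assumption)+

end
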